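(* Let $n\ge 2$ be an integer and let $\beta_1, \beta_2, \dots, \beta_n$ be congruent circles on a line $s$ in the plane. If a circle $\alpha$ of radius $a$ touches $s$, and touches $\beta_1$ and $\beta_n$ externally at points $C$ and $B$, respectively, and $A$ is the foot of the perpendicular from $B$ to $s$, then the following relations hold. (i) $(n-1)|AB|=|BC|$. (ii) $2a=\dfrac{((n-1)^2+4)\,|AB|}{4}$.
   Context: Circles $\gamma_1,\gamma_2,\dots,\gamma_n$ are called congruent circles on a line $s$ if they are congruent (have equal radii), all touch (are tangent to) $s$ from the same side, $\gamma_1$ and $\gamma_2$ touch each other, and for each $i=3,4,\dots,n$ the circle $\gamma_i$ touches $\gamma_{i-1}$ from the side opposite to $\gamma_1$ (so they form a row of distinct circles along $s$, each externally tangent to the next). The circle $\alpha$ is not required to be disjoint from, or distinct from, the circles $\beta_2,\dots,\beta_{n-1}$. The notation $|PQ|$ denotes the length of the segment $PQ$. *)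

theory Defs
  imports "HOL-Analysis.Analysis"
begin

type_synonym plane = "real ^ 2"

definition is_line :: "plane set \<Rightarrow> bool" where
  "is_line s \<longleftrightarrow> affine s \<and> aff_dim s = 1"

definition circle_of_radius :: "plane set \<Rightarrow> real \<Rightarrow> bool" where
  "circle_of_radius \<gamma> r \<longleftrightarrow> 0 < r \<and> (\<exists>c. \<gamma> = sphere c r)"

definition touches_line_at :: "plane set \<Rightarrow> plane set \<Rightarrow> plane \<Rightarrow> bool" where
  "touches_line_at \<gamma> s P \<longleftrightarrow> \<gamma> \<inter> s = {P}"

definition touches_line :: "plane set \<Rightarrow> plane set \<Rightarrow> bool" where
  "touches_line \<gamma> s \<longleftrightarrow> (\<exists>P. touches_line_at \<gamma> s P)"

text \<open>
  Two circles touch if they have exactly one common point; this covers internal and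
  external contact.  The contact is external if the open discs bounded by the circles
  (for a circle, \<^const>\<open>inside\<close> is that disc) are disjoint.
\<close>

definition circles_touch_at :: "plane set \<Rightarrow> plane set \<Rightarrow> plane \<Rightarrow> bool" where
  "circles_touch_at \<gamma> \<delta> P \<longleftrightarrow> \<gamma> \<inter> \<delta> = {P}"

definition circles_touch :: "plane set \<Rightarrow> plane set \<Rightarrow> bool" where
  "circles_touch \<gamma> \<delta> \<longleftrightarrow> (\<exists>P. circles_touch_at \<gamma> \<delta> P)"

definition circles_touch_externally_at :: "plane set \<Rightarrow> plane set \<Rightarrow> plane \<Rightarrow> bool" where
  "circles_touch_externally_at \<gamma> \<delta> P \<longleftrightarrow>
     circles_touch_at \<gamma> \<delta> P \<and> inside \<gamma> \<inter> inside \<delta> = {}"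

text \<open>
  Two figures lie on the same side of a line if no segment joining a point of one to a
  point of the other, both taken off the line, meets the line.
\<close>

definition on_same_side :: "plane set \<Rightarrow> plane set \<Rightarrow> plane set \<Rightarrow> bool" where
  "on_same_side s \<gamma> \<delta> \<longleftrightarrow> (\<forall>P\<in>\<gamma> - s. \<forall>Q\<in>\<delta> - s. closed_segment P Q \<inter> s = {})"

text \<open>
  For circles touching \<open>s\<close> from the same side, \<open>\<gamma>\<close> and \<open>\<epsilon>\<close> are on opposite sides of
  \<open>\<delta>\<close> if the contact point of \<open>\<delta>\<close> with \<open>s\<close> lies strictly between those of \<open>\<gamma>\<close> and \<open>\<epsilon>\<close>.
\<close>

definition on_opposite_sides_along ::
    "plane set \<Rightarrow> plane set \<Rightarrow> plane set \<Rightarrow> plane set \<Rightarrow> bool" where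
  "on_opposite_sides_along s \<gamma> \<delta> \<epsilon> \<longleftrightarrow>
     (\<exists>P Q R. touches_line_at \<gamma> s P \<and> touches_line_at \<delta> s Q \<and> touches_line_at \<epsilon> s R \<and>
        Q \<in> open_segment P R)"

definition congruent_circles_on_line :: "nat \<Rightarrow> (nat \<Rightarrow> plane set) \<Rightarrow> plane set \<Rightarrow> bool" where
  "congruent_circles_on_line n \<gamma> s \<longleftrightarrow>
     (\<exists>r. \<forall>i\<in>{1..n}. circle_of_radius (\<gamma> i) r) \<and>
     (\<forall>i\<in>{1..n}. touches_line (\<gamma> i) s) \<and>
     (\<forall>i\<in>{1..n}. \<forall>j\<in>{1..n}. on_same_side s (\<gamma> i) (\<gamma> j)) \<and>
     circles_touch (\<gamma> 1) (\<gamma> 2) \<and>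
     (\<forall>i\<in>{3..n}. circles_touch (\<gamma> i) (\<gamma> (i - 1)) \<and>
                   on_opposite_sides_along s (\<gamma> 1) (\<gamma> (i - 1)) (\<gamma> i))"

definition foot_of_perpendicular :: "plane \<Rightarrow> plane \<Rightarrow> plane set \<Rightarrow> bool" where
  "foot_of_perpendicular F P s \<longleftrightarrow> F \<in> s \<and> (\<forall>Q\<in>s. orthogonal (P - F) (Q - F))"

end

theory Submission
  imports Defs
begin

text \<open>
  Take Cartesian coordinates in which \<open>s\<close> is the first axis and the circles \<open>\<beta> i\<close>, of radius \<open>r\<close>,
  lie above it, so that \<open>\<beta> i\<close> has centre \<open>(x i, r)\<close> with \<open>x i = x 1 + (i - 1) (x 2 - x 1)\<close> and
  \<open>\<bar>x 2 - x 1\<bar> = 2 r\<close>.  A circle of radius \<open>a\<close> on \<open>s\<close> touching a circle of radius \<open>r\<close> on the same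
  side of \<open>s\<close> has its contact point with \<open>s\<close> at distance \<open>2 sqrt (a r)\<close> from that of the other
  circle.  Hence \<open>\<alpha>\<close> touches \<open>s\<close> midway between \<open>x 1\<close> and \<open>x n\<close>, which gives
  \<open>4 a = (n - 1)\<^sup>2 r\<close>.  The points of contact divide the segments joining the centres in the
  ratio \<open>a : r\<close>, so \<open>|AB| = 2 a r / (a + r)\<close> and \<open>|BC| = 2 (n - 1) r a / (a + r)\<close>.
\<close>

subsection \<open>Spheres\<close>

lemma inside_sphere:
  fixes c :: "'a::euclidean_space"
  shows "inside (sphere c r) = ball c r"
  using inside_frontier_eq_interior[of "cball c r"] by (simp add: frontier_cball)

text \<open>The point dividing the segment from \<open>c\<close> to \<open>d\<close> in the ratio
  \<open>r : R\<close> works. In the next lemma this excludes internal contact and crossing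
  circles.\<close>

lemma ball_Int_ball_nonempty:
  fixes c d :: "'a::real_normed_vector"
  assumes "0 < r" "0 < R" "dist c d < r + R"
  shows "ball c r \<inter> ball d R \<noteq> {}"
proof -
  define P where "P = c + (r / (r + R)) *\<^sub>R (d - c)"
  have "dist c P = r / (r + R) * dist c d"
    using assms by (simp add: P_def dist_norm norm_minus_commute)
  also have "\<dots> < r / (r + R) * (r + R)"
    using assms by (intro mult_strict_left_mono) auto
  finally have 1: "dist c P < r"
    using assms by simp
  have "d - P = (1 - r / (r + R)) *\<^sub>R (d - c)"
    by (simp add: P_def algebra_simps)
  also have "1 - r / (r + R) = R / (r + R)"
    using assms by (simp add: field_simps)
  finally have "dist d P = R / (r + R) * dist c d"
    using assms by (simp add: dist_norm norm_minus_commute)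
  also have "\<dots> < R / (r + R) * (r + R)"
    using assms by (intro mult_strict_left_mono) auto
  finally have 2: "dist d P < R"
    using assms by simp
  show ?thesis
    using 1 2 by auto
qed

text \<open>Disjoint open discs bound the distance of the centres from below, the common point
  bounds it from above. Equality in the triangle inequality then puts \<open>P\<close> on the
  segment of centres; the second claim records its position as a weighted sum.\<close>

lemma touch_externally_dist:
  assumes "0 < r" "0 < R" "circles_touch_externally_at (sphere c r) (sphere d R) P"
  shows "dist c d = r + R" "(r + R) *\<^sub>R P = R *\<^sub>R c + r *\<^sub>R d"
proof -
  have P: "dist c P = r" "dist d P = R"
    using assms(3) by (auto simp: circles_touch_externally_at_def circles_touch_at_def)
  have "ball c r \<inter> ball d R = {}"
    using assms(3) by (simp add: circles_touch_externally_at_def inside_sphere)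
  then have "\<not> dist c d < r + R"
    using ball_Int_ball_nonempty assms(1,2) by blast
  moreover have "dist c d \<le> r + R"
    using P dist_triangle2[of c d P] by simp
  ultimately show D: "dist c d = r + R"
    by simp
  have n: "norm (P - c) = r" "norm (d - P) = R"
    using P by (auto simp: dist_norm norm_minus_commute)
  \<comment> \<open>The equality case makes \<open>P - c\<close> and \<open>d - P\<close> point in
    the same direction.\<close>
  have "norm ((P - c) + (d - P)) = norm (P - c) + norm (d - P)"
    using D n by (simp add: dist_norm norm_minus_commute)
  from norm_triangle_eq[THEN iffD1, OF this]
  have "r *\<^sub>R (d - P) = R *\<^sub>R (P - c)"
    by (simp only: n)
  then show "(r + R) *\<^sub>R P = R *\<^sub>R c + r *\<^sub>R d"
    by (simp add: algebra_simps)
qed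

lemma equal_spheres_touch_dist:
  assumes "0 < r" "circles_touch (sphere c r) (sphere d r)"
  shows "dist c d = 2 * r"
proof -
  obtain P where P: "sphere c r \<inter> sphere d r = {P}"
    using assms(2) by (auto simp: circles_touch_def circles_touch_at_def)
  then have PP: "dist c P = r" "dist d P = r"
    by auto
  \<comment> \<open>The point reflection in the midpoint of the centres swaps the two circles, hence fixes \<open>P\<close>.\<close>
  have "dist c (c + d - P) = r" "dist d (c + d - P) = r"
    using PP by (auto simp: dist_norm norm_minus_commute)
  then have "c + d - P \<in> sphere c r \<inter> sphere d r"
    by simp
  then have "c + d - P = P"
    using P by auto
  then have "d - c = 2 *\<^sub>R (P - c)"
    by (simp add: algebra_simps scaleR_2)
  then have "norm (d - c) = 2 * norm (P - c)"
    by simp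
  then show ?thesis
    using PP by (simp add: dist_norm norm_minus_commute)
qed

subsection \<open>Coordinates adapted to a line\<close>

locale line_frame =
  fixes p u v :: plane
  assumes norm_u: "norm u = 1" and norm_v: "norm v = 1" and orth: "u \<bullet> v = 0"
begin

definition pt :: "real \<Rightarrow> real \<Rightarrow> plane" where
  "pt t h = p + t *\<^sub>R u + h *\<^sub>R v"

lemma frame_inner [simp]: "u \<bullet> u = 1" "v \<bullet> v = 1" "u \<bullet> v = 0" "v \<bullet> u = 0"
  using norm_u norm_v orth by (simp_all add: norm_eq_1 inner_commute)

lemma pt_diff: "pt t h - pt t' h' = (t - t') *\<^sub>R u + (h - h') *\<^sub>R v"
  by (simp add: pt_def algebra_simps)

lemma pt_inner_diff:
  "(pt t h - pt t' h') \<bullet> (pt k l - pt k' l') = (t - t') * (k - k') + (h - h') * (l - l')"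
  unfolding pt_diff by (simp add: inner_add_left inner_add_right)

lemma dist_pt: "dist (pt t h) (pt t' h') = sqrt ((t - t')\<^sup>2 + (h - h')\<^sup>2)"
  by (simp add: dist_norm norm_eq_sqrt_inner pt_inner_diff power2_eq_square)

lemma dist_pt_power2: "(dist (pt t h) (pt t' h'))\<^sup>2 = (t - t')\<^sup>2 + (h - h')\<^sup>2"
  by (simp add: dist_pt)

lemma dist_pt_horizontal [simp]: "dist (pt t h) (pt t' h) = \<bar>t - t'\<bar>"
  by (simp add: dist_pt)

lemma dist_pt_vertical [simp]: "dist (pt t h) (pt t h') = \<bar>h - h'\<bar>"
  by (simp add: dist_pt)

lemma pt_eq_iff [simp]: "pt t h = pt t' h' \<longleftrightarrow> t = t' \<and> h = h'"
proof -
  have "pt t h = pt t' h' \<longleftrightarrow> (t - t')\<^sup>2 + (h - h')\<^sup>2 = 0"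
    by (metis dist_eq_0_iff dist_pt_power2 zero_eq_power2)
  then show ?thesis
    by (simp add: sum_power2_eq_zero_iff)
qed

lemma pt_convex_combination:
  "(1 - k) *\<^sub>R pt t h + k *\<^sub>R pt t' h' = pt (t + k * (t' - t)) ((1 - k) * h + k * h')"
  by (simp add: pt_def algebra_simps)

lemma scaleR_pt:
  assumes "k + l = m" "m \<noteq> 0" "m *\<^sub>R P = k *\<^sub>R pt t h + l *\<^sub>R pt t' h'"
  shows "P = pt ((k * t + l * t') / m) ((k * h + l * h') / m)"
proof -
  have "k *\<^sub>R pt t h + l *\<^sub>R pt t' h' = m *\<^sub>R p + (k * t + l * t') *\<^sub>R u + (k * h + l * h') *\<^sub>R v"
    by (simp add: pt_def algebra_simps flip: assms(1))
  also have "\<dots> = m *\<^sub>R pt ((k * t + l * t') / m) ((k * h + l * h') / m)"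
    using assms(2) by (simp add: pt_def scaleR_add_right)
  finally show ?thesis
    using assms by simp
qed

text \<open>Two orthonormal vectors are independent, hence span the two-dimensional space, so inner
  products with them serve as coordinates.\<close>

lemma ex_pt: "\<exists>t h. P = pt t h"
proof -
  have "u \<noteq> v"
    by (metis frame_inner(2,3) zero_neq_one)
  then have ne: "u \<noteq> v" "0 \<notin> {u, v}"
    using norm_u norm_v by auto
  have o: "pairwise orthogonal {u, v}"
    by (auto simp: pairwise_def orthogonal_def)
  have ind: "independent {u, v}"
    using pairwise_orthogonal_independent[OF o ne(2)] .
  have "UNIV \<subseteq> span {u, v}"
    using ne by (intro card_ge_dim_independent[OF _ ind]) auto
  then have "(\<Sum>i\<in>{u, v}. ((P - p) \<bullet> i) *\<^sub>R i) = P - p"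
    using o norm_u norm_v by (intro orthonormal_basis_expand) auto
  then have "P = pt ((P - p) \<bullet> u) ((P - p) \<bullet> v)"
    using ne by (simp add: pt_def algebra_simps)
  then show ?thesis
    by blast
qed

abbreviation axis :: "plane set" where
  "axis \<equiv> range (\<lambda>t. pt t 0)"

lemma touches_axis:
  assumes "0 < r" "touches_line_at (sphere c r) axis P"
  obtains t where "P = pt t 0" "c = pt t r \<or> c = pt t (- r)"
proof -
  have P: "sphere c r \<inter> axis = {P}"
    using assms(2) by (simp add: touches_line_at_def)
  then obtain t where t: "P = pt t 0"
    by auto
  obtain k h where c: "c = pt k h"
    using ex_pt by blast
  \<comment> \<open>The circle and the axis are symmetric in the perpendicular through the centre.\<close>
  have "dist c (pt t 0) = r"
    using P t by auto
  then have "dist c (pt (2 * k - t) 0) = r"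
    by (simp add: c dist_pt power2_commute)
  then have "pt (2 * k - t) 0 \<in> sphere c r \<inter> axis"
    by auto
  then have "k = t"
    using P t by auto
  then have "\<bar>h\<bar> = r"
    using \<open>dist c (pt t 0) = r\<close> by (simp add: c)
  then show thesis
    using that t c \<open>k = t\<close> by (cases "0 \<le> h") auto
qed

lemma touches_axis_unique:
  assumes "0 < r" "touches_line_at (sphere (pt t h) r) axis P"
  shows "P = pt t 0"
  using assms by (elim touches_axis) auto

text \<open>If the second circle were below the axis, the segment from the top of the first, at
  height \<open>2 * r\<close>, to the bottom of the second, at height \<open>- 2 * R\<close>, would
  cross the axis. The crossing parameter is \<open>r / (r + R)\<close>.\<close>

lemma same_side_axis:
  assumes "0 < r" "0 < R" "on_same_side axis (sphere (pt t r) r) (sphere (pt t' h) R)"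
    "h = R \<or> h = - R"
  shows "h = R"
proof (rule ccontr)
  assume "h \<noteq> R"
  then have h: "h = - R"
    using assms by simp
  have "pt t (2 * r) \<in> sphere (pt t r) r - axis"
    using assms by auto
  moreover have "pt t' (- 2 * R) \<in> sphere (pt t' h) R - axis"
    using assms h by auto
  ultimately have "closed_segment (pt t (2 * r)) (pt t' (- 2 * R)) \<inter> axis = {}"
    using assms(3) unfolding on_same_side_def by blast
  moreover have "(1 - r / (r + R)) *\<^sub>R pt t (2 * r) + (r / (r + R)) *\<^sub>R pt t' (- 2 * R)
      = pt (t + r / (r + R) * (t' - t)) ((1 - r / (r + R)) * (2 * r) + r / (r + R) * (- 2 * R))"
    by (rule pt_convex_combination)
  moreover have "(1 - r / (r + R)) * (2 * r) + r / (r + R) * (- 2 * R) = 0"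
    using assms by (simp add: field_simps)
  moreover have "(1 - r / (r + R)) *\<^sub>R pt t (2 * r) + (r / (r + R)) *\<^sub>R pt t' (- 2 * R)
      \<in> closed_segment (pt t (2 * r)) (pt t' (- 2 * R))"
    unfolding in_segment using assms by (intro exI[of _ "r / (r + R)"]) auto
  ultimately show False
    by auto
qed

lemma pt_open_segment:
  assumes "pt k 0 \<in> open_segment (pt t 0) (pt t' 0)"
  obtains l where "0 < l" "l < 1" "k = t + l * (t' - t)"
proof -
  obtain l where l: "0 < l" "l < 1" "pt k 0 = (1 - l) *\<^sub>R pt t 0 + l *\<^sub>R pt t' 0"
    using assms by (auto simp: in_segment)
  then show thesis
    using that by (simp add: pt_convex_combination)
qed

end

text \<open>The origin is the contact point, \<open>u\<close> runs along the line and
  \<open>v\<close> points to the centre. Tangency yields their orthogonality.\<close>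

lemma line_frame_of_tangent:
  assumes "is_line s" "0 < r" "touches_line (sphere c r) s"
  obtains p u v where "line_frame u v" "s = range (\<lambda>t. line_frame.pt p u v t 0)"
    "c = line_frame.pt p u v 0 r"
proof -
  obtain P where P: "sphere c r \<inter> s = {P}"
    using assms(3) by (auto simp: touches_line_def touches_line_at_def)
  have s: "affine s" "aff_dim s = 1"
    using assms(1) by (auto simp: is_line_def)
  have "P \<in> s" "dist c P = r"
    using P by auto
  have "s \<noteq> {P}"
    using s by auto
  then obtain Q where Q: "Q \<in> s" "Q \<noteq> P"
    using \<open>P \<in> s\<close> by blast
  have "affine hull {P, Q} = s"
    using s Q \<open>P \<in> s\<close>
    by (intro affine_dim_equal) (auto simp: hull_minimal aff_dim_affine_hull)
  then have s_range: "s = range (\<lambda>t. P + t *\<^sub>R (Q - P))"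
    by (simp add: affine_hull_2_alt)
  define u where "u = (Q - P) /\<^sub>R norm (Q - P)"
  define v where "v = (c - P) /\<^sub>R r"
  have nu: "norm u = 1"
    using Q by (simp add: u_def)
  have nv: "norm v = 1"
    using \<open>dist c P = r\<close> \<open>0 < r\<close> by (simp add: v_def dist_norm)
  have s_u: "s = range (\<lambda>t. P + t *\<^sub>R u)"
  proof -
    have "P + t *\<^sub>R (Q - P) = P + (t * norm (Q - P)) *\<^sub>R u"
      "P + t *\<^sub>R u = P + (t / norm (Q - P)) *\<^sub>R (Q - P)" for t
      using Q by (simp_all add: u_def divide_inverse)
    then show ?thesis
      unfolding s_range by (metis (no_types, lifting) image_subset_iff rangeI subset_antisym)
  qed
  \<comment> \<open>The second intersection of the circle with the line coincides with \<open>P\<close>.\<close>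
  define k where "k = 2 * ((c - P) \<bullet> u)"
  have "(dist c (P + k *\<^sub>R u))\<^sup>2 = (c - P - k *\<^sub>R u) \<bullet> (c - P - k *\<^sub>R u)"
    by (simp add: dist_norm power2_norm_eq_inner algebra_simps)
  also have "\<dots> = (c - P) \<bullet> (c - P) - 2 * k * ((c - P) \<bullet> u) + k * k * (u \<bullet> u)"
    by (simp add: inner_diff_left[of "c - P"] inner_diff_right[of _ "c - P"] inner_commute)
  also have "\<dots> = (dist c P)\<^sup>2"
    using nu by (simp add: norm_eq_1 k_def dist_norm power2_norm_eq_inner)
  finally have "dist c (P + k *\<^sub>R u) = r"
    using \<open>dist c P = r\<close> \<open>0 < r\<close> by (simp add: power2_eq_iff_nonneg)
  then have "P + k *\<^sub>R u \<in> sphere c r \<inter> s"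
    by (auto simp: s_u)
  then have "k *\<^sub>R u = 0"
    using P by simp
  then have "u \<bullet> v = 0"
    using nu by (auto simp: k_def v_def inner_commute)
  then interpret line_frame P u v
    using nu nv by unfold_locales
  have "c = pt 0 r"
    unfolding pt_def using \<open>0 < r\<close> by (simp add: v_def)
  moreover have "s = range (\<lambda>t. pt t 0)"
    by (simp add: s_u pt_def)
  ultimately show thesis
    using that line_frame_axioms by blast
qed

subsection \<open>Rows of congruent circles\<close>

text \<open>Contact fixes the distance of consecutive centres and betweenness the direction of the
  step. The step \<open>d\<close> is signed because the row may run either way along the
  axis.\<close>

lemma (in line_frame) congruent_circles_centres:
  assumes "congruent_circles_on_line n \<beta> axis" "2 \<le> n" "0 < r"
    and "\<And>i. i \<in> {1..n} \<Longrightarrow> \<beta> i = sphere (c i) r" "c 1 = pt t r"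
  obtains d where "\<bar>d\<bar> = 2 * r" "\<And>i. i \<in> {1..n} \<Longrightarrow> c i = pt (t + (real i - 1) * d) r"
proof -
  have touch: "touches_line (\<beta> i) axis" if "i \<in> {1..n}" for i
    using assms(1) that by (simp add: congruent_circles_on_line_def)
  have side: "on_same_side axis (\<beta> i) (\<beta> j)" if "i \<in> {1..n}" "j \<in> {1..n}" for i j
    using assms(1) that by (simp add: congruent_circles_on_line_def)
  have next_circle: "circles_touch (\<beta> i) (\<beta> (i - 1))"
    "on_opposite_sides_along axis (\<beta> 1) (\<beta> (i - 1)) (\<beta> i)" if "i \<in> {3..n}" for i
    using assms(1) that by (simp_all add: congruent_circles_on_line_def)
  have "\<exists>x. c i = pt x r" if i: "i \<in> {1..n}" for i
  proof -
    obtain P where "touches_line_at (sphere (c i) r) axis P"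
      using touch[OF i] assms(4)[OF i] by (auto simp: touches_line_def)
    then obtain x where x: "c i = pt x r \<or> c i = pt x (- r)"
      using touches_axis[OF \<open>0 < r\<close>] by metis
    then obtain h where h: "c i = pt x h" "h = r \<or> h = - r"
      by blast
    have "on_same_side axis (sphere (pt t r) r) (sphere (pt x h) r)"
      using side[of 1 i] i assms(2,4,5) h by simp
    then have "h = r"
      using same_side_axis assms(3) h by blast
    then show ?thesis
      using h by blast
  qed
  then obtain x where x: "\<And>i. i \<in> {1..n} \<Longrightarrow> c i = pt (x i) r"
    by metis
  have beta: "\<beta> i = sphere (pt (x i) r) r" if "i \<in> {1..n}" for i
    using assms(4) x that by simp
  define d where "d = x 2 - x 1"
  have x1: "x 1 = t"
    using x[of 1] assms(2,5) pt_eq_iff by (metis atLeastAtMost_iff le_trans one_le_numeral order_refl)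
  have "circles_touch (\<beta> 1) (\<beta> 2)"
    using assms(1) by (simp add: congruent_circles_on_line_def)
  then have d: "\<bar>d\<bar> = 2 * r"
    using equal_spheres_touch_dist[OF assms(3)] beta[of 1] beta[of 2] assms(2)
    by (fastforce simp: d_def)
  \<comment> \<open>The induction starts at 2, where the claim is the definition of
    \<open>d\<close>; betweenness is available from the third circle on.\<close>
  have step: "x i = t + (real i - 1) * d" if "2 \<le> i" "i \<le> n" for i
    using that
  proof (induction i rule: dec_induct)
    case base
    then show ?case
      by (simp add: d_def flip: x1)
  next
    case (step i)
    have i: "i \<in> {1..n}" "Suc i \<in> {1..n}" "Suc i \<in> {3..n}"
      using step by auto
    have IH: "x i = t + (real i - 1) * d"
      using step by simp
    have "circles_touch (sphere (pt (x (Suc i)) r) r) (sphere (pt (x i) r) r)"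
      using next_circle(1)[OF i(3)] beta[OF i(1)] beta[OF i(2)] by simp
    then have D: "\<bar>x (Suc i) - x i\<bar> = 2 * r"
      using equal_spheres_touch_dist[OF assms(3)] by fastforce
    obtain P Q R where PQR: "touches_line_at (\<beta> 1) axis P" "touches_line_at (\<beta> i) axis Q"
      "touches_line_at (\<beta> (Suc i)) axis R" "Q \<in> open_segment P R"
      using next_circle(2)[OF i(3)] by (auto simp: on_opposite_sides_along_def)
    have "P = pt t 0" "Q = pt (x i) 0" "R = pt (x (Suc i)) 0"
      using PQR beta[OF i(1)] beta[OF i(2)] beta[of 1] x1 assms(2)
        touches_axis_unique[OF assms(3)] by auto
    then obtain l where l: "0 < l" "l < 1" "x i = t + l * (x (Suc i) - t)"
      using PQR(4) by (auto elim: pt_open_segment)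
    \<comment> \<open>Betweenness excludes the alternative \<open>x (Suc i) = x i - d\<close>.\<close>
    have "x (Suc i) \<noteq> x i - d"
    proof
      assume a: "x (Suc i) = x i - d"
      \<comment> \<open>Stepping back would put the contact point of circle \<open>Suc i\<close> at
        \<open>t + (real i - 2) * d\<close>, too close to \<open>t\<close> for that of circle
        \<open>i\<close> to lie between.\<close>
      have "(real i - 1) * d = (l * (real i - 2)) * d"
        using l(3) by (simp add: a IH algebra_simps)
      then have "real i - 1 = l * (real i - 2)"
        using d assms(3) by (subst (asm) mult_cancel_right) auto
      also have "\<dots> \<le> 1 * (real i - 2)"
        using l step by (intro mult_right_mono) auto
      finally show False
        by simp
    qed
    then have "x (Suc i) = x i + d"
      using D d by linarith
    then show ?case
      by (simp add: IH algebra_simps)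
  qed
  have "c i = pt (t + (real i - 1) * d) r" if "i \<in> {1..n}" for i
    using step[of i] x[OF that] x1 that by (cases "i = 1") auto
  then show thesis
    using that d by blast
qed

section \<open>The circle \<alpha> and the metric relations\<close>

theorem theorem2:
  fixes n :: nat and \<beta> :: "nat \<Rightarrow> plane set" and \<alpha> s :: "plane set"
    and a :: real and A B C :: plane
  assumes "n \<ge> 2"
    and "is_line s"
    and "congruent_circles_on_line n \<beta> s"
    and "circle_of_radius \<alpha> a"
    and "touches_line \<alpha> s"
    and "circles_touch_externally_at \<alpha> (\<beta> 1) C"
    and "circles_touch_externally_at \<alpha> (\<beta> n) B"
    and "foot_of_perpendicular A B s"
  shows "(real n - 1) * dist A B = dist B C \<and>
         2 * a = ((real n - 1)\<^sup>2 + 4) * dist A B / 4"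
proof -
  obtain r where r: "\<And>i. i \<in> {1..n} \<Longrightarrow> circle_of_radius (\<beta> i) r"
    using assms(3) unfolding congruent_circles_on_line_def by blast
  then have "0 < r"
    using assms(1) by (force simp: circle_of_radius_def)
  obtain c where c: "\<And>i. i \<in> {1..n} \<Longrightarrow> \<beta> i = sphere (c i) r"
    using r unfolding circle_of_radius_def by metis
  obtain ca where ca: "\<alpha> = sphere ca a" and "0 < a"
    using assms(4) by (auto simp: circle_of_radius_def)
  have "touches_line (sphere (c 1) r) s"
  proof -
    have "1 \<in> {1..n}"
      using assms(1) by simp
    then show ?thesis
      using assms(3) c unfolding congruent_circles_on_line_def by metis
  qed
  then obtain p u v where fr: "line_frame u v" "s = range (\<lambda>t. line_frame.pt p u v t 0)"
    "c 1 = line_frame.pt p u v 0 r"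
    using line_frame_of_tangent[OF assms(2) \<open>0 < r\<close>] by metis
  interpret line_frame p u v
    by (rule fr(1))
  obtain d where d: "\<bar>d\<bar> = 2 * r" and centres: "\<And>i. i \<in> {1..n} \<Longrightarrow> c i = pt (0 + (real i - 1) * d) r"
    using congruent_circles_centres[of n \<beta> r c 0] assms(1,3) fr(2,3) c \<open>0 < r\<close> by metis
  define m where "m = real n - 1"
  have "1 \<le> m"
    using assms(1) by (simp add: m_def)
  have beta: "\<beta> 1 = sphere (pt 0 r) r" "\<beta> n = sphere (pt (m * d) r) r"
    using c[of 1] c[of n] centres[of 1] centres[of n] assms(1) by (simp_all add: m_def)
  \<comment> \<open>Tangency leaves the side of \<alpha> open; external contact with two different
    circles of the row decides it below.\<close>
  obtain q h where q: "ca = pt q h" and h: "h = a \<or> h = - a"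
    using assms(5) fr(2) touches_axis[OF \<open>0 < a\<close>] by (metis ca touches_line_def)
  note ext1 = touch_externally_dist[OF \<open>0 < a\<close> \<open>0 < r\<close> assms(6)[unfolded ca q beta]]
  note extn = touch_externally_dist[OF \<open>0 < a\<close> \<open>0 < r\<close> assms(7)[unfolded ca q beta]]
  have e1: "q\<^sup>2 + (h - r)\<^sup>2 = (a + r)\<^sup>2"
    using dist_pt_power2[of q h 0 r] ext1(1) by simp
  have en: "(q - m * d)\<^sup>2 + (h - r)\<^sup>2 = (a + r)\<^sup>2"
    using dist_pt_power2[of q h "m * d" r] extn(1) by simp
  have "m * d \<noteq> 0"
    using \<open>1 \<le> m\<close> d \<open>0 < r\<close> by auto
  \<comment> \<open>The centre of \<alpha> has the same distance \<open>a + r\<close> from both end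
    centres, so it projects to their midpoint.\<close>
  have "m * d * (m * d - 2 * q) = (q - m * d)\<^sup>2 - q\<^sup>2"
    by (simp add: power2_eq_square algebra_simps)
  also have "\<dots> = 0"
    using e1 en by simp
  finally have md: "m * d = 2 * q"
    using \<open>m * d \<noteq> 0\<close> by auto
  \<comment> \<open>With \<open>h = - a\<close> the vertical distance alone is \<open>a + r\<close>,
    forcing \<open>q = 0\<close> and hence \<open>m * d = 0\<close>.\<close>
  have "h = a"
  proof (rule ccontr)
    assume "h \<noteq> a"
    then have "q\<^sup>2 = 0"
      using e1 h by (auto simp: power2_eq_square algebra_simps)
    then show False
      using md \<open>m * d \<noteq> 0\<close> by simp
  qed
  have "q\<^sup>2 = 4 * a * r"
    using e1 \<open>h = a\<close> by (simp add: power2_eq_square algebra_simps)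
  moreover have absq: "\<bar>q\<bar> = m * r"
    using arg_cong[OF md, of abs] d \<open>1 \<le> m\<close> by (simp add: abs_mult)
  \<comment> \<open>Both sides equal \<open>q\<^sup>2\<close>, by the two preceding facts.\<close>
  ultimately have "r * (m\<^sup>2 * r) = r * (4 * a)"
    by (metis (no_types) mult.assoc mult.commute power2_abs power2_eq_square)
  then have a4: "m\<^sup>2 * r = 4 * a"
    using \<open>0 < r\<close> by simp
  \<comment> \<open>Both contact points get the same height, so \<open>dist B C\<close> is a
    difference of first coordinates.\<close>
  have C: "C = pt (r * q / (a + r)) (2 * a * r / (a + r))"
    using scaleR_pt[OF _ _ ext1(2)] \<open>0 < a\<close> \<open>0 < r\<close> \<open>h = a\<close> by (simp add: algebra_simps)
  have B: "B = pt ((r * q + a * (2 * q)) / (a + r)) (2 * a * r / (a + r))"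
    using scaleR_pt[OF _ _ extn(2)] \<open>0 < a\<close> \<open>0 < r\<close> \<open>h = a\<close> md by (simp add: algebra_simps)
  obtain tB hB where B': "B = pt tB hB" "hB = 2 * a * r / (a + r)"
    using B by blast
  obtain tA where A: "A = pt tA 0"
    using assms(8) fr(2) by (auto simp: foot_of_perpendicular_def)
  \<comment> \<open>Testing perpendicularity against the projection of \<open>B\<close> turns the
    inner product into \<open>(tB - tA)\<^sup>2\<close>.\<close>
  have "(B - A) \<bullet> (pt tB 0 - A) = 0"
    using assms(8) fr(2) by (auto simp: foot_of_perpendicular_def orthogonal_def)
  then have "A = pt tB 0"
    by (simp add: A B' pt_inner_diff)
  then have AB: "dist A B = 2 * a * r / (a + r)"
    using \<open>0 < a\<close> \<open>0 < r\<close> by (simp add: B')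
  have "dist B C = \<bar>a * (2 * q) / (a + r)\<bar>"
    by (simp add: B C add_divide_distrib)
  also have "\<dots> = 2 * a * (m * r) / (a + r)"
    using \<open>0 < a\<close> \<open>0 < r\<close> by (simp add: abs_mult absq)
  finally have BC: "dist B C = m * dist A B"
    by (simp add: AB)
  have "(m\<^sup>2 + 4) * dist A B / 4 = 2 * a * (m\<^sup>2 * r + 4 * r) / (4 * (a + r))"
    by (simp add: AB algebra_simps)
  also have "\<dots> = 2 * a * (4 * (a + r)) / (4 * (a + r))"
    by (simp add: a4)
  also have "\<dots> = 2 * a"
    using \<open>0 < a\<close> \<open>0 < r\<close> by simp
  finally show ?thesis
    using BC by (simp add: m_def)
qed

end
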